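(* Let $S_{\Gamma\Gamma}^{(i)}$, $d_\Gamma^{(i)}$, $I_{\Gamma\Gamma}^{(i)}$ ($i\in\{1,\dots,p\}$), $M_{\Gamma\Gamma}$ and $S_{\Gamma\Gamma}=\sum_{i=1}^pS_{\Gamma\Gamma}^{(i)}$ be as described in the context. Assume that the matrices $I_{\Gamma\Gamma}^{(i)}-M_{\Gamma\Gamma}^{-1}S_{\Gamma\Gamma}^{(i)}=(q^{(i)}_{l,t})_{l,t}$, $i\in\{1,\dots,p\}$, are real and entry-wise of non-different signs, i.e., for all $i,j\in\{1,\dots,p\}$ and all $l,t$, $$q^{(i)}_{l,t}<0\implies q^{(j)}_{l,t}\le 0,\qquad q^{(i)}_{l,t}>0\implies q^{(j)}_{l,t}\ge 0.$$ If $$\rho\left(\left|I_{\Gamma\Gamma}-M_{\Gamma\Gamma}^{-1}S_{\Gamma\Gamma}\right|\right)<1,$$ then the asynchronous primal Schur method is convergent.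
   Context: Matrices and vectors have entries in $\mathbb{K}=\mathbb{R}$ or $\mathbb{C}$. $\rho(\cdot)$ is the spectral radius and $|\mathcal A|$ is the entry-wise absolute value of a matrix or vector $\mathcal A$. Setting (primal Schur domain decomposition with $p$ subdomains and interface $\Gamma$). For each $i\in\{1,\dots,p\}$ one is given matrices $A_{II}^{(i)}$ (square, nonsingular), $A_{I\Gamma}^{(i)}$, $A_{\Gamma I}^{(i)}$, $A_{\Gamma\Gamma}^{(i)}$ and vectors $b_I^{(i)}$, $b_\Gamma^{(i)}$ of compatible sizes; the size of the $I$-blocks may depend on $i$, and the index $\Gamma$ refers to one common finite index set. (When subdomain $i$ touches only a part $\Gamma_l$ of $\Gamma$, these blocks are obtained from local blocks through a Boolean restriction matrix $R^{(i)}_{\Gamma_l\Gamma}$ from $\Gamma$ to $\Gamma_l$, e.g. $A_{\Gamma\Gamma}^{(i)}={R^{(i)}_{\Gamma_l\Gamma}}^{\mathsf T}A^{(i)}_{\Gamma_l\Gamma_l}R^{(i)}_{\Gamma_l\Gamma}$.) Define $$S_{\Gamma\Gamma}^{(i)}:=A_{\Gamma\Gamma}^{(i)}-A_{\Gamma I}^{(i)}{A_{II}^{(i)}}^{-1}A_{I\Gamma}^{(i)},\quad d_\Gamma^{(i)}:=b_\Gamma^{(i)}-A_{\Gamma I}^{(i)}{A_{II}^{(i)}}^{-1}b_I^{(i)},\quad S_{\Gamma\Gamma}:=\sum_{i=1}^pS_{\Gamma\Gamma}^{(i)},\quad d_\Gamma:=\sum_{i=1}^pd_\Gamma^{(i)}.$$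 The interface problem is $S_{\Gamma\Gamma}x_\Gamma=d_\Gamma$. Let $I_{\Gamma\Gamma}$ be the identity matrix on $\Gamma$, let $M_{\Gamma\Gamma}$ be a nonsingular matrix on $\Gamma$, and let $I_{\Gamma\Gamma}^{(1)},\dots,I_{\Gamma\Gamma}^{(p)}$ be matrices on $\Gamma$ with $\sum_{i=1}^pI_{\Gamma\Gamma}^{(i)}=I_{\Gamma\Gamma}$. Asynchronous primal Schur method. Given initial vectors $x_\Gamma^{(i),0}$ ($i\in\{1,\dots,p\}$), sets $P^{(k)}\subseteq\{1,\dots,p\}$ ($k\in\mathbb{N}$) and maps $\tau_j^i:\mathbb{N}\to\mathbb{N}$ ($i,j\in\{1,\dots,p\}$) with $\tau_j^i(k)\le k$, such that (a) for every $i$, the set $\{k\in\mathbb{N}: i\in P^{(k)}\}$ is infinite, and (b) for all $i,j$, $\lim_{k\to\infty}\tau_j^i(k)=+\infty$, the method generates, for $k\in\mathbb{N}$ and $i\in\{1,\dots,p\}$, $$y_\Gamma^{(i),k}:=I_{\Gamma\Gamma}^{(i)}x_\Gamma^{(i),k}+M_{\Gamma\Gamma}^{-1}\left(d_\Gamma^{(i)}-S_{\Gamma\Gamma}^{(i)}x_\Gamma^{(i),k}\right),\qquad x_\Gamma^{(i),k+1}=\begin{cases}\sum_{j=1}^py_\Gamma^{(j),\tau_j^i(k)},& i\in P^{(k)},\\ x_\Gamma^{(i),k},& i\notin P^{(k)}.\end{cases}$$ The method is called convergent if, for all choices of the initial vectors $x_\Gamma^{(i),0}$, of sets $P^{(k)}\subseteq\{1,\dots,p\}$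 such that $\{k\in\mathbb{N}: i\in P^{(k)}\}$ is infinite for every $i$, and of maps $\tau_j^i:\mathbb{N}\to\mathbb{N}$ such that $\tau_j^i(k)\le k$ for all $k$ and $\lim_{k\to\infty}\tau_j^i(k)=+\infty$ for all $i,j$, each sequence $(x_\Gamma^{(i),k})_{k}$, $i\in\{1,\dots,p\}$, converges as $k\to\infty$ to the solution $x_\Gamma$ of $S_{\Gamma\Gamma}x_\Gamma=d_\Gamma$. *)

theory Defs
  imports "HOL-Analysis.Analysis" "Jordan_Normal_Form.Spectral_Radius"
    "Jordan_Normal_Form.Gauss_Jordan_Elimination"
begin

text \<open>
  The scalar type is any \<open>'a :: real_normed_field\<close>, a class with instances \<open>real\<close> and \<open>complex\<close>
  whose \<open>norm\<close> is the absolute value. The index set \<open>\<Gamma>\<close> is \<open>{0..<n}\<close>, subdomains are numbered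
  \<open>{1..p}\<close>, and families indexed by subdomains are functions on \<open>nat\<close> whose values outside
  \<open>{1..p}\<close> are irrelevant.
\<close>

text \<open>Only meaningful for invertible matrices.\<close>

definition mat_inv :: "'a :: field mat \<Rightarrow> 'a mat" where
  "mat_inv A = the (mat_inverse A)"

definition mat_sum :: "nat \<Rightarrow> (nat \<Rightarrow> 'a :: comm_monoid_add mat) \<Rightarrow> nat set \<Rightarrow> 'a mat" where
  "mat_sum n A J = mat n n (\<lambda>(l, t). \<Sum>i\<in>J. A i $$ (l, t))"

abbreviation vec_sum :: "nat \<Rightarrow> (nat \<Rightarrow> 'a :: comm_monoid_add vec) \<Rightarrow> nat set \<Rightarrow> 'a vec" where
  "vec_sum n \<equiv> finsum_vec TYPE('a) n"

definition mat_abs :: "'a :: real_normed_field mat \<Rightarrow> real mat" where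
  "mat_abs A = map_mat norm A"

text \<open>The library's spectral radius is defined for complex matrices; a real matrix is embedded.\<close>

definition real_spectral_radius :: "real mat \<Rightarrow> real" where
  "real_spectral_radius A = spectral_radius (map_mat complex_of_real A)"

definition schur_complement ::
  "'a :: field mat \<Rightarrow> 'a mat \<Rightarrow> 'a mat \<Rightarrow> 'a mat \<Rightarrow> 'a mat" where
  "schur_complement AII AIG AGI AGG = AGG - AGI * mat_inv AII * AIG"

definition schur_rhs ::
  "'a :: field mat \<Rightarrow> 'a mat \<Rightarrow> 'a vec \<Rightarrow> 'a vec \<Rightarrow> 'a vec" where
  "schur_rhs AII AGI bI bG = bG - (AGI * mat_inv AII) *\<^sub>v bI"

definition async_schedule ::
  "nat \<Rightarrow> (nat \<Rightarrow> nat set) \<Rightarrow> (nat \<Rightarrow> nat \<Rightarrow> nat \<Rightarrow> nat) \<Rightarrow> bool" where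
  "async_schedule p P \<tau> \<longleftrightarrow>
     (\<forall>k. P k \<subseteq> {1..p}) \<and>
     (\<forall>i\<in>{1..p}. infinite {k. i \<in> P k}) \<and>
     (\<forall>i\<in>{1..p}. \<forall>j\<in>{1..p}. (\<forall>k. \<tau> i j k \<le> k) \<and> filterlim (\<tau> i j) at_top sequentially)"

definition local_update ::
  "(nat \<Rightarrow> 'a :: field mat) \<Rightarrow> (nat \<Rightarrow> 'a vec) \<Rightarrow> (nat \<Rightarrow> 'a mat) \<Rightarrow> 'a mat
     \<Rightarrow> nat \<Rightarrow> 'a vec \<Rightarrow> 'a vec" where
  "local_update S d IG M i x = IG i *\<^sub>v x + mat_inv M *\<^sub>v (d i - S i *\<^sub>v x)"

text \<open>
  \<open>x i k\<close> is the iterate of subdomain \<open>i\<close> at step \<open>k\<close>. Since \<open>\<tau> i j k \<le> k\<close> in a schedule, the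
  recursion has, for \<open>i \<in> {1..p}\<close>, exactly one solution for any given initial vectors.
\<close>

definition async_primal_schur_sequence ::
  "nat \<Rightarrow> nat \<Rightarrow> (nat \<Rightarrow> 'a :: field mat) \<Rightarrow> (nat \<Rightarrow> 'a vec) \<Rightarrow> (nat \<Rightarrow> 'a mat) \<Rightarrow> 'a mat
     \<Rightarrow> (nat \<Rightarrow> 'a vec) \<Rightarrow> (nat \<Rightarrow> nat set) \<Rightarrow> (nat \<Rightarrow> nat \<Rightarrow> nat \<Rightarrow> nat)
     \<Rightarrow> (nat \<Rightarrow> nat \<Rightarrow> 'a vec) \<Rightarrow> bool" where
  "async_primal_schur_sequence p n S d IG M x0 P \<tau> x \<longleftrightarrow>
     (\<forall>i\<in>{1..p}. x i 0 = x0 i) \<and>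
     (\<forall>k. \<forall>i\<in>{1..p}. x i (Suc k) =
        (if i \<in> P k
         then vec_sum n (\<lambda>j. local_update S d IG M j (x j (\<tau> i j k))) {1..p}
         else x i k))"

text \<open>
  The method can only be convergent if the interface problem has a unique solution, which is what
  \<^emph>\<open>the\<close> solution refers to. Convergence in the finite-dimensional space of vectors is expressed
  componentwise.
\<close>

definition async_primal_schur_convergent ::
  "nat \<Rightarrow> nat \<Rightarrow> (nat \<Rightarrow> 'a :: real_normed_field mat) \<Rightarrow> (nat \<Rightarrow> 'a vec)
     \<Rightarrow> (nat \<Rightarrow> 'a mat) \<Rightarrow> 'a mat \<Rightarrow> bool" where
  "async_primal_schur_convergent p n S d IG M \<longleftrightarrow>
     (\<exists>!xs. xs \<in> carrier_vec n \<and> mat_sum n S {1..p} *\<^sub>v xs = vec_sum n d {1..p}) \<and>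
     (\<forall>xs x0 P \<tau> x.
        xs \<in> carrier_vec n \<and> mat_sum n S {1..p} *\<^sub>v xs = vec_sum n d {1..p} \<and>
        (\<forall>i\<in>{1..p}. x0 i \<in> carrier_vec n) \<and>
        async_schedule p P \<tau> \<and>
        async_primal_schur_sequence p n S d IG M x0 P \<tau> x \<longrightarrow>
        (\<forall>i\<in>{1..p}. \<forall>l<n. (\<lambda>k. x i k $ l) \<longlonglongrightarrow> xs $ l))"

end

theory Submission
  imports Defs
begin

text \<open>
  Write \<open>N\<close> for the inverse of \<open>M\<close>, \<open>T\<^sub>j = I\<^sub>j - N S\<^sub>j\<close> for the iteration matrix of subdomain \<open>j\<close>, and
  \<open>B = |I - N S|\<close>. The solution \<open>x\<close> of the interface problem is a fixed point of the summed local
  updates, because the \<open>I\<^sub>j\<close> sum to the identity and the local residuals sum to zero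
  (\<open>sum_local_update_solution\<close>). So the errors evolve linearly: an active subdomain \<open>i\<close> replaces its
  error by the sum over \<open>j\<close> of \<open>T\<^sub>j\<close> applied to a delayed error of subdomain \<open>j\<close>. These delayed errors
  differ from one \<open>j\<close> to another, so a componentwise estimate only involves the sum of the \<open>|T\<^sub>j|\<close>.
  This is where the sign condition enters: entries of the same sign do not cancel, so the sum of the
  \<open>|T\<^sub>j|\<close> is the absolute value of the sum of the \<open>T\<^sub>j\<close>, which is \<open>B\<close> (\<open>abs_sum_same_sign\<close>).

  Since \<open>B\<close> is nonnegative with spectral radius below 1, there are positive weights \<open>w\<close> and
  \<open>\<alpha> < 1\<close> with \<open>B w \<le> \<alpha> w\<close> (\<open>weights_of_spectral_radius_less_1\<close>). In other words, one update
  contracts the maximum norm weighted by \<open>w\<close>, uniformly in the subdomain. A weighted maximum norm is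
  the right one for asynchronous iterations because the sets \<open>|e| \<le> C w\<close> are boxes: it does not
  matter from which iteration each component of the data is taken, as long as it lies in the box.
  Waiting until all data in use are recent enough, and then until every subdomain has been updated,
  shrinks the box by the factor \<open>\<alpha>\<close>; repeating this gives convergence
  (\<open>async_weighted_max_norm_contraction\<close>).

  The same weights give existence and uniqueness of \<open>x\<close>: a vector \<open>v\<close> in the kernel of \<open>S\<close> satisfies
  \<open>v = (I - N S) v\<close>, hence \<open>|v| \<le> B |v|\<close>, which is impossible for a nonzero \<open>v\<close>
  (\<open>weighted_subinvariant_imp_zero\<close>).
\<close>

section \<open>Asynchronous contractions in a weighted maximum norm\<close>

text \<open>
  The hypothesis on updates says that data in the box of radius \<open>C\<close>, whatever their delays, produce a
  result in the box of radius \<open>\<alpha> * C\<close>. All errors stay in some initial box. If from some time on all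
  errors are in a box, then, since the indices \<open>\<tau> i j k\<close> of the data in use tend to infinity, later
  updates use only data from that box; since every subdomain is updated again and again, eventually all errors are in the box
  shrunk by \<open>\<alpha>\<close>, where idle steps and further updates keep them.
\<close>

lemma async_weighted_max_norm_contraction:
  fixes e :: "nat \<Rightarrow> nat \<Rightarrow> nat \<Rightarrow> real"
  assumes sched: "async_schedule p P \<tau>"
    and nonneg: "\<And>i k l. i \<in> {1..p} \<Longrightarrow> l < n \<Longrightarrow> 0 \<le> e i k l"
    and w: "\<And>l. l < n \<Longrightarrow> 0 < w l"
    and \<alpha>: "0 \<le> \<alpha>" "\<alpha> < 1"
    and idle: "\<And>i k l. i \<in> {1..p} \<Longrightarrow> i \<notin> P k \<Longrightarrow> l < n \<Longrightarrow> e i (Suc k) l = e i k l"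
    and update: "\<And>i k l C. i \<in> {1..p} \<Longrightarrow> i \<in> P k \<Longrightarrow> l < n \<Longrightarrow> 0 \<le> C \<Longrightarrow>
        (\<And>j t. j \<in> {1..p} \<Longrightarrow> t < n \<Longrightarrow> e j (\<tau> i j k) t \<le> C * w t) \<Longrightarrow>
        e i (Suc k) l \<le> \<alpha> * C * w l"
    and il: "i \<in> {1..p}" "l < n"
  shows "(\<lambda>k. e i k l) \<longlonglongrightarrow> 0"
proof -
  have inf: "infinite {k. i \<in> P k}" if "i \<in> {1..p}" for i
    using sched that by (auto simp: async_schedule_def)
  have delay: "\<tau> i j k \<le> k" if "i \<in> {1..p}" "j \<in> {1..p}" for i j k
    using sched that by (auto simp: async_schedule_def)
  have lim: "filterlim (\<tau> i j) at_top sequentially" if "i \<in> {1..p}" "j \<in> {1..p}" for i j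
    using sched that by (auto simp: async_schedule_def)
  \<comment> \<open>Any bound of all initial weighted errors serves as radius; the sum avoids a maximum over a
    possibly empty set.\<close>
  define C where "C = (\<Sum>i\<in>{1..p}. \<Sum>l<n. e i 0 l / w l)"
  have C: "0 \<le> C"
    unfolding C_def using nonneg w by (intro sum_nonneg divide_nonneg_pos) auto
  have C0: "e i 0 l \<le> C * w l" if "i \<in> {1..p}" "l < n" for i l
  proof -
    have "e i 0 l / w l \<le> (\<Sum>l<n. e i 0 l / w l)"
      using that nonneg[of i] w by (intro member_le_sum) (auto intro!: divide_nonneg_pos)
    also have "\<dots> \<le> C" unfolding C_def
      using that nonneg w
      by (intro member_le_sum[where f = "\<lambda>i. \<Sum>l<n. e i 0 l / w l"])
        (auto intro!: sum_nonneg divide_nonneg_pos)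
    finally show ?thesis using w[OF that(2)] by (simp add: divide_le_eq)
  qed
  have level: "\<exists>K. \<forall>k\<ge>K. \<forall>i\<in>{1..p}. \<forall>l<n. e i k l \<le> \<alpha> ^ m * C * w l" for m
  proof (induction m)
    case 0
    have "\<forall>i\<in>{1..p}. \<forall>l<n. e i k l \<le> C * w l" for k
    proof (induction k rule: less_induct)
      case (less k)
      show ?case
      proof (cases k)
        case 0
        then show ?thesis using C0 by auto
      next
        case (Suc k')
        show ?thesis
        proof (intro ballI allI impI)
          fix i l assume i: "i \<in> {1..p}" and l: "l < n"
          show "e i k l \<le> C * w l"
          proof (cases "i \<in> P k'")
            case True
            have "e i (Suc k') l \<le> \<alpha> * C * w l"
            proof (rule update[OF i True l C])
              fix j t assume j: "j \<in> {1..p}" and t: "t < n"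
              show "e j (\<tau> i j k') t \<le> C * w t"
                using less[of "\<tau> i j k'"] delay[OF i j, of k'] Suc j t by auto
            qed
            also have "\<dots> \<le> C * w l"
              using \<alpha> C w[OF l] by (intro mult_right_mono mult_left_le_one_le) auto
            finally show ?thesis using Suc by simp
          next
            case False
            then show ?thesis using idle[OF i False l] less[of k'] Suc i l by auto
          qed
        qed
      qed
    qed
    then show ?case by auto
  next
    case (Suc m)
    then obtain K where "\<forall>k\<ge>K. \<forall>i\<in>{1..p}. \<forall>l<n. e i k l \<le> \<alpha> ^ m * C * w l" by blast
    then have K: "\<And>k i l. K \<le> k \<Longrightarrow> i \<in> {1..p} \<Longrightarrow> l < n \<Longrightarrow> e i k l \<le> \<alpha> ^ m * C * w l"
      by blast
    have "eventually (\<lambda>k. \<forall>i\<in>{1..p}. \<forall>j\<in>{1..p}. K \<le> \<tau> i j k) sequentially"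
      using lim by (intro eventually_ball_finite ballI) (auto simp: filterlim_at_top)
    \<comment> \<open>From \<open>K1\<close> on, every update uses only data in the current box.\<close>
    then obtain K1 where K1: "\<And>k i j. K1 \<le> k \<Longrightarrow> i \<in> {1..p} \<Longrightarrow> j \<in> {1..p} \<Longrightarrow> K \<le> \<tau> i j k"
      unfolding eventually_sequentially by blast
    have shrink: "e i (Suc k) l \<le> \<alpha> ^ Suc m * C * w l"
      if i: "i \<in> {1..p}" and l: "l < n" and k: "K1 \<le> k" and P: "i \<in> P k" for i l k
    proof -
      have "e i (Suc k) l \<le> \<alpha> * (\<alpha> ^ m * C) * w l"
        using K K1[OF k i] \<alpha> C by (intro update[OF i P l]) auto
      then show ?thesis by (simp add: mult_ac)
    qed
    have "\<exists>k\<ge>K1. i \<in> P k" if "i \<in> {1..p}" for i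
      using inf[OF that] by (auto simp: infinite_nat_iff_unbounded_le)
    \<comment> \<open>The update at step \<open>u i\<close> takes subdomain \<open>i\<close> into the smaller box.\<close>
    then obtain u where u: "\<And>i. i \<in> {1..p} \<Longrightarrow> K1 \<le> u i \<and> i \<in> P (u i)" by metis
    have after: "e i k l \<le> \<alpha> ^ Suc m * C * w l"
      if i: "i \<in> {1..p}" and l: "l < n" and k: "Suc (u i) \<le> k" for i l k
      using k
    proof (induction k rule: dec_induct)
      case base
      show ?case using shrink[OF i l] u[OF i] by auto
    next
      case (step k)
      show ?case
      proof (cases "i \<in> P k")
        case True
        then show ?thesis using shrink[OF i l] step u[OF i] by auto
      next
        case False
        then show ?thesis using idle[OF i False l] step by simp
      qed
    qed
    have "Suc (u i) \<le> k" if "(\<Sum>i\<in>{1..p}. Suc (u i)) \<le> k" "i \<in> {1..p}" for i k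
      using member_le_sum[of i "{1..p}" "\<lambda>i. Suc (u i)"] that by force
    then show ?case using after by blast
  qed
  show ?thesis
  proof (rule LIMSEQ_I)
    fix \<epsilon> :: real assume \<epsilon>: "0 < \<epsilon>"
    have "(\<lambda>m. \<alpha> ^ m * (C * w l)) \<longlonglongrightarrow> 0"
      using \<alpha> by (intro tendsto_mult_left_zero LIMSEQ_power_zero) auto
    then have "eventually (\<lambda>m. \<alpha> ^ m * (C * w l) < \<epsilon>) sequentially"
      using \<epsilon> by (rule order_tendstoD)
    then obtain m where m: "\<alpha> ^ m * (C * w l) < \<epsilon>"
      unfolding eventually_sequentially by blast
    from level[of m] obtain K where "\<forall>k\<ge>K. e i k l \<le> \<alpha> ^ m * C * w l"
      using il by blast
    then have "\<forall>k\<ge>K. norm (e i k l - 0) < \<epsilon>"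
      using m nonneg[OF il] by (force simp: mult_ac)
    then show "\<exists>K. \<forall>k\<ge>K. norm (e i k l - 0) < \<epsilon>" by blast
  qed
qed

section \<open>Contraction weights of a nonnegative matrix with spectral radius below 1\<close>

lemma smult_mult_mat_vec:
  fixes A :: "'b :: comm_ring_1 mat"
  assumes "A \<in> carrier_mat m n" "v \<in> carrier_vec n"
  shows "(a \<cdot>\<^sub>m A) *\<^sub>v v = a \<cdot>\<^sub>v (A *\<^sub>v v)"
  using assms by (intro eq_vecI) (auto simp: scalar_prod_def sum_distrib_left mult_ac)

text \<open>
  The eigenvalues of \<open>B / r\<close> are those of \<open>B\<close> divided by \<open>r\<close>, so its spectral radius is below 1,
  and the Jordan normal form bounds the powers. Scaling by an \<open>r\<close> between the spectral radius of \<open>B\<close>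
  and 1 turns this boundedness into the geometric decay of the powers of \<open>B\<close> itself.
\<close>

lemma bounded_powers_above_spectral_radius:
  fixes B :: "real mat"
  assumes B: "B \<in> carrier_mat n n" and n: "0 < n"
    and r: "real_spectral_radius B < r" "0 < r"
  obtains c where "\<And>k l t. l < n \<Longrightarrow> t < n \<Longrightarrow> (((1 / r) \<cdot>\<^sub>m B) ^\<^sub>m k) $$ (l, t) \<le> c"
proof -
  interpret of_real_hom: semiring_hom complex_of_real by unfold_locales auto
  let ?E = "(1 / r) \<cdot>\<^sub>m B"
  let ?A = "map_mat complex_of_real B"
  let ?F = "map_mat complex_of_real ?E"
  have A: "?A \<in> carrier_mat n n" and E: "?E \<in> carrier_mat n n" and F: "?F \<in> carrier_mat n n"
    using B by auto
  have "cmod z < 1" if z: "z \<in> spectrum ?F" for z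
  proof -
    from z obtain v where v: "v \<in> carrier_vec n" "v \<noteq> 0\<^sub>v n" "?F *\<^sub>v v = z \<cdot>\<^sub>v v"
      using F by (auto simp: spectrum_def eigenvalue_def eigenvector_def)
    have "?A = of_real r \<cdot>\<^sub>m ?F" using B r by (intro eq_matI) auto
    then have "?A *\<^sub>v v = of_real r \<cdot>\<^sub>v (?F *\<^sub>v v)"
      using smult_mult_mat_vec[OF F v(1)] by simp
    also have "\<dots> = (of_real r * z) \<cdot>\<^sub>v v" using v by (simp add: smult_smult_assoc)
    finally have "of_real r * z \<in> spectrum ?A"
      using v A by (auto simp: spectrum_def eigenvalue_def eigenvector_def)
    then have "cmod (of_real r * z) \<le> spectral_radius ?A"
      by (intro spectral_radius_mem_max(2)[OF A n]) auto
    also have "\<dots> < r" using r(1) by (simp add: real_spectral_radius_def)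
    finally have "r * cmod z < r * 1" using r(2) by (simp add: norm_mult)
    then show ?thesis using r(2) by (rule mult_left_less_imp_less[OF _ less_imp_le])
  qed
  then have "spectral_radius ?F < 1"
    using spectral_radius_mem_max(1)[OF F n] by auto
  from spectral_radius_jnf_norm_bound_less_1_upper_triangular[OF F this]
  obtain c where c: "\<And>k. norm_bound (?F ^\<^sub>m k) c" by blast
  show thesis
  proof (rule that)
    fix k l t assume lt: "l < n" "t < n"
    have "cmod ((?F ^\<^sub>m k) $$ (l, t)) \<le> c"
      using c[of k] lt carrier_matD[OF pow_carrier_mat[OF F, of k]]
      unfolding norm_bound_def by metis
    also have "?F ^\<^sub>m k = map_mat complex_of_real (?E ^\<^sub>m k)"
      by (rule of_real_hom.mat_hom_pow[OF E, symmetric])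
    finally show "(?E ^\<^sub>m k) $$ (l, t) \<le> c" using lt B by auto
  qed
qed

text \<open>
  The weights are a partial sum of the Neumann series applied to the all-ones vector \<open>\<one>\<close>: for
  \<open>w = \<one> + B \<one> + \<dots> + B\<^sup>N \<one>\<close> the product \<open>B w\<close> is \<open>w - \<one> + B\<^sup>N\<^sup>+\<^sup>1 \<one>\<close>, which is at
  most \<open>w - 1/2\<close> once the powers are small. Subtracting a constant from every component is at least
  a contraction by a fixed factor, as \<open>w\<close> is bounded. In contrast to a Perron eigenvector, these
  weights are positive without any irreducibility assumption.
\<close>

lemma weights_of_spectral_radius_less_1:
  fixes B :: "real mat"
  assumes B: "B \<in> carrier_mat n n"
    and nonneg: "\<And>l t. l < n \<Longrightarrow> t < n \<Longrightarrow> 0 \<le> B $$ (l, t)"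
    and rho: "real_spectral_radius B < 1"
  obtains w \<alpha> where "\<And>l. l < n \<Longrightarrow> 0 < w l" "0 \<le> \<alpha>" "\<alpha> < 1"
    "\<And>l. l < n \<Longrightarrow> (\<Sum>t<n. B $$ (l, t) * w t) \<le> \<alpha> * w l"
proof (cases "n = 0")
  case True
  then show ?thesis using that[of "\<lambda>_. 1" 0] by auto
next
  case False
  then have n: "0 < n" by simp
  \<comment> \<open>The lower bound \<open>1/2\<close> makes \<open>r\<close> positive.\<close>
  define r where "r = max (1/2) ((1 + real_spectral_radius B) / 2)"
  have r: "real_spectral_radius B < r" "0 < r" "r < 1"
    using rho by (auto simp: r_def max_def)
  define E where "E = (1 / r) \<cdot>\<^sub>m B"
  from bounded_powers_above_spectral_radius[OF B n r(1,2)]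
  obtain c where c: "\<And>k l t. l < n \<Longrightarrow> t < n \<Longrightarrow> (E ^\<^sub>m k) $$ (l, t) \<le> c"
    unfolding E_def by blast
  have E: "E \<in> carrier_mat n n" using B by (simp add: E_def)
  have B_eq: "B $$ (l, t) = r * E $$ (l, t)" if "l < n" "t < n" for l t
    using that B r by (simp add: E_def)
  have E_nonneg: "0 \<le> E $$ (l, t)" if "l < n" "t < n" for l t
    using that B r nonneg by (simp add: E_def)
  have pow: "E ^\<^sub>m k \<in> carrier_mat n n" for k using E by simp
  have pow_Suc: "(E ^\<^sub>m Suc k) $$ (l, t) = (\<Sum>s<n. E $$ (l, s) * (E ^\<^sub>m k) $$ (s, t))"
    if "l < n" "t < n" for k l t
  proof -
    have "E ^\<^sub>m Suc k = E * E ^\<^sub>m k"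
    proof (induction k)
      case (Suc k)
      have "E ^\<^sub>m Suc (Suc k) = (E * E ^\<^sub>m k) * E" using Suc by simp
      also have "\<dots> = E * (E ^\<^sub>m k * E)" by (rule assoc_mult_mat[OF E pow E])
      finally show ?case by simp
    qed (use E in auto)
    then show ?thesis using that E pow[of k]
      by (auto simp: scalar_prod_def atLeast0LessThan)
  qed
  have pow_nonneg: "0 \<le> (E ^\<^sub>m k) $$ (l, t)" if "l < n" "t < n" for k l t
    using that
  proof (induction k arbitrary: l t)
    case 0
    then show ?case using E by auto
  next
    case (Suc k)
    then show ?case unfolding pow_Suc[OF Suc.prems]
      by (intro sum_nonneg mult_nonneg_nonneg E_nonneg) auto
  qed
  \<comment> \<open>The vector \<open>E\<^sup>k \<one>\<close>, so that \<open>r ^ k * u k\<close> is \<open>B\<^sup>k \<one>\<close>.\<close>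
  define u where "u k l = (\<Sum>t<n. (E ^\<^sub>m k) $$ (l, t))" for k l
  have u0: "u 0 l = 1" if "l < n" for l
    using that E by (simp add: u_def if_distrib cong: if_cong)
  have u_Suc: "(\<Sum>t<n. E $$ (l, t) * u k t) = u (Suc k) l" if "l < n" for k l
    using that unfolding u_def
    by (subst sum_distrib_left, subst sum.swap) (auto simp: pow_Suc simp del: pow_mat.simps)
  have u_nonneg: "0 \<le> u k l" if "l < n" for k l
    unfolding u_def using that by (intro sum_nonneg pow_nonneg) auto
  have u_le: "u k l \<le> n * c" if "l < n" for k l
    unfolding u_def using that c sum_bounded_above[of "{..<n}" "\<lambda>t. (E ^\<^sub>m k) $$ (l, t)" c] by simp
  have "(\<lambda>N. r ^ Suc N * (n * c)) \<longlonglongrightarrow> 0"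
    using r by (intro tendsto_mult_left_zero LIMSEQ_Suc LIMSEQ_power_zero) auto
  then have "eventually (\<lambda>N. r ^ Suc N * (n * c) < 1/2) sequentially"
    by (rule order_tendstoD) simp
  then obtain N where N: "r ^ Suc N * (n * c) < 1/2"
    unfolding eventually_sequentially by blast
  define w where "w l = (\<Sum>k<Suc N. r ^ k * u k l)" for l
  have w: "1 \<le> w l" if "l < n" for l
  proof -
    have "r ^ 0 * u 0 l \<le> w l" unfolding w_def
      using that r u_nonneg by (intro member_le_sum) auto
    then show ?thesis using u0[OF that] by simp
  qed
  have Bw: "(\<Sum>t<n. B $$ (l, t) * w t) \<le> w l - 1/2" if l: "l < n" for l
  proof -
    have "(\<Sum>t<n. B $$ (l, t) * w t) = (\<Sum>t<n. \<Sum>k<Suc N. r ^ Suc k * (E $$ (l, t) * u k t))"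
      using l by (intro sum.cong) (auto simp: w_def B_eq sum_distrib_left mult_ac simp del: sum.lessThan_Suc)
    also have "\<dots> = (\<Sum>k<Suc N. r ^ Suc k * u (Suc k) l)"
      by (subst sum.swap) (simp only: u_Suc[OF l] flip: sum_distrib_left)
    also have "\<dots> = (\<Sum>k<Suc (Suc N). r ^ k * u k l) - 1"
      by (subst (2) sum.lessThan_Suc_shift) (simp add: u0[OF l])
    also have "\<dots> = w l - 1 + r ^ Suc N * u (Suc N) l" by (simp add: w_def)
    also have "r ^ Suc N * u (Suc N) l \<le> r ^ Suc N * (n * c)"
      using r u_le[OF l] by (intro mult_left_mono) auto
    finally show ?thesis using N by linarith
  qed
  define W where "W = (\<Sum>l<n. w l)"
  have W: "w l \<le> W" if "l < n" for l
    unfolding W_def using that w by (intro member_le_sum) (auto intro: order_trans[OF zero_le_one])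
  have W1: "1 \<le> W" using W[OF n] w[OF n] by linarith
  show ?thesis
  proof (rule that[of w "1 - 1 / (2 * W)"])
    fix l assume l: "l < n"
    show "0 < w l" using w[OF l] by linarith
    have "w l / (2 * W) \<le> 1/2" using W[OF l] W1 by (simp add: field_simps)
    then show "(\<Sum>t<n. B $$ (l, t) * w t) \<le> (1 - 1 / (2 * W)) * w l"
      using Bw[OF l] by (simp add: algebra_simps)
  qed (use W1 in \<open>auto simp: field_simps\<close>)
qed

text \<open>
  Let \<open>C\<close> be the weighted maximum norm of \<open>e\<close>, attained at component \<open>s\<close>. Then
  \<open>C w\<^sub>s = e\<^sub>s \<le> \<alpha> C w\<^sub>s\<close>, which forces \<open>C = 0\<close>.
\<close>

lemma weighted_subinvariant_imp_zero:
  fixes e w :: "nat \<Rightarrow> real" and b :: "nat \<Rightarrow> nat \<Rightarrow> real"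
  assumes b: "\<And>l t. l < n \<Longrightarrow> t < n \<Longrightarrow> 0 \<le> b l t" and w: "\<And>l. l < n \<Longrightarrow> 0 < w l"
    and bw: "\<And>l. l < n \<Longrightarrow> (\<Sum>t<n. b l t * w t) \<le> \<alpha> * w l" and \<alpha>: "\<alpha> < 1"
    and e: "\<And>l. l < n \<Longrightarrow> 0 \<le> e l" "\<And>l. l < n \<Longrightarrow> e l \<le> (\<Sum>t<n. b l t * e t)"
    and l: "l < n"
  shows "e l = 0"
proof -
  define C where "C = Max ((\<lambda>t. e t / w t) ` {..<n})"
  have C_ge: "e t \<le> C * w t" if "t < n" for t
  proof -
    have "e t / w t \<le> C" unfolding C_def using that by (intro Max_ge) auto
    then show ?thesis using w[OF that] by (simp add: divide_le_eq)
  qed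
  have "C \<in> (\<lambda>t. e t / w t) ` {..<n}" unfolding C_def using l by (intro Max_in) auto
  then obtain s where s: "s < n" "e s = C * w s" using w by force
  have C_nonneg: "0 \<le> C"
    using e(1)[OF s(1)] s w[OF s(1)] by (simp add: zero_le_mult_iff)
  have "C * w s \<le> (\<Sum>t<n. b s t * e t)" using e(2)[OF s(1)] s by simp
  also have "\<dots> \<le> (\<Sum>t<n. b s t * (C * w t))"
    using C_ge b s by (intro sum_mono mult_left_mono) auto
  also have "\<dots> = C * (\<Sum>t<n. b s t * w t)" by (simp add: sum_distrib_left mult_ac)
  also have "\<dots> \<le> C * (\<alpha> * w s)" using bw s C_nonneg by (intro mult_left_mono) auto
  finally have "C * ((1 - \<alpha>) * w s) \<le> 0" by (simp add: algebra_simps)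
  then have "C = 0"
    using C_nonneg \<alpha> w[OF s(1)] by (auto simp: mult_le_0_iff)
  then show ?thesis using C_ge[OF l] e(1)[OF l] by simp
qed

section \<open>Sums of matrices, inverses and linear systems\<close>

lemma index_mult_mat_vec_sum:
  assumes "A \<in> carrier_mat m n" "v \<in> carrier_vec n" "l < m"
  shows "(A *\<^sub>v v) $ l = (\<Sum>t<n. A $$ (l, t) * v $ t)"
  using assms by (auto simp: scalar_prod_def atLeast0LessThan)

lemma index_mat_sum [simp]:
  "l < n \<Longrightarrow> t < n \<Longrightarrow> mat_sum n A J $$ (l, t) = (\<Sum>i\<in>J. A i $$ (l, t))"
  by (simp add: mat_sum_def)

lemma mat_sum_carrier [simp]: "mat_sum n A J \<in> carrier_mat n n"
  by (simp add: mat_sum_def)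

lemma mat_sum_mult_vec:
  fixes A :: "nat \<Rightarrow> 'a :: comm_ring_1 mat"
  assumes "\<And>i. i \<in> J \<Longrightarrow> A i \<in> carrier_mat n n" and v: "v \<in> carrier_vec n" and l: "l < n"
  shows "(mat_sum n A J *\<^sub>v v) $ l = (\<Sum>i\<in>J. (A i *\<^sub>v v) $ l)"
proof -
  have "(mat_sum n A J *\<^sub>v v) $ l = (\<Sum>t<n. \<Sum>i\<in>J. A i $$ (l, t) * v $ t)"
    using v l by (simp add: index_mult_mat_vec_sum[OF mat_sum_carrier] sum_distrib_right
      del: index_mult_mat_vec)
  also have "\<dots> = (\<Sum>i\<in>J. \<Sum>t<n. A i $$ (l, t) * v $ t)" by (rule sum.swap)
  also have "\<dots> = (\<Sum>i\<in>J. (A i *\<^sub>v v) $ l)"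
    using assms by (intro sum.cong refl index_mult_mat_vec_sum[symmetric]) auto
  finally show ?thesis .
qed

lemma mult_mat_sum:
  fixes A :: "nat \<Rightarrow> 'a :: comm_ring_1 mat"
  assumes "\<And>i. i \<in> J \<Longrightarrow> A i \<in> carrier_mat n n" and N: "N \<in> carrier_mat n n"
    and l: "l < n" and t: "t < n"
  shows "(N * mat_sum n A J) $$ (l, t) = (\<Sum>i\<in>J. (N * A i) $$ (l, t))"
proof -
  have *: "(N * C) $$ (l, t) = (\<Sum>s<n. N $$ (l, s) * C $$ (s, t))"
    if "C \<in> carrier_mat n n" for C
    using that N l t by (auto simp: scalar_prod_def atLeast0LessThan)
  have "(N * mat_sum n A J) $$ (l, t) = (\<Sum>s<n. \<Sum>i\<in>J. N $$ (l, s) * A i $$ (s, t))"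
    using l t by (simp add: *[OF mat_sum_carrier] sum_distrib_left)
  also have "\<dots> = (\<Sum>i\<in>J. \<Sum>s<n. N $$ (l, s) * A i $$ (s, t))" by (rule sum.swap)
  also have "\<dots> = (\<Sum>i\<in>J. (N * A i) $$ (l, t))"
    using assms(1) by (intro sum.cong refl *[symmetric]) auto
  finally show ?thesis .
qed

lemma mat_inv_carrier:
  fixes A :: "'a :: field mat"
  assumes A: "A \<in> carrier_mat n n" and inv: "invertible_mat A"
  shows "mat_inv A \<in> carrier_mat n n"
proof -
  from inv obtain B where B: "A * B = 1\<^sub>m n" "B * A = 1\<^sub>m (dim_row B)"
    using A by (auto simp: invertible_mat_def inverts_mat_def)
  have "dim_col B = n" using arg_cong[OF B(1), of dim_col] by simp
  moreover have "dim_row B = n" using arg_cong[OF B(2), of dim_col] A by simp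
  ultimately have "A \<in> Units (ring_mat TYPE('a) n ())"
    using A B by (auto simp: Units_def ring_mat_def)
  then obtain C where "mat_inverse A = Some C"
    using mat_inverse(1)[OF A, of "()"] by (cases "mat_inverse A") auto
  then show ?thesis
    using mat_inverse(2)[OF A] by (auto simp: mat_inv_def)
qed

lemma unique_solution_of_trivial_kernel:
  fixes A :: "'a :: field mat"
  assumes A: "A \<in> carrier_mat n n" and b: "b \<in> carrier_vec n"
    and kernel: "\<And>v. v \<in> carrier_vec n \<Longrightarrow> A *\<^sub>v v = 0\<^sub>v n \<Longrightarrow> v = 0\<^sub>v n"
  shows "\<exists>!x. x \<in> carrier_vec n \<and> A *\<^sub>v x = b"
proof -
  have "det A \<noteq> 0" using kernel det_0_iff_vec_prod_zero_field[OF A] by blast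
  from det_non_zero_imp_unit[OF A this, of "()"]
  obtain X where X: "X \<in> carrier_mat n n" "A * X = 1\<^sub>m n" "X * A = 1\<^sub>m n"
    by (auto simp: Units_def ring_mat_def)
  show ?thesis
  proof (rule ex1I[of _ "X *\<^sub>v b"])
    show "X *\<^sub>v b \<in> carrier_vec n \<and> A *\<^sub>v (X *\<^sub>v b) = b"
      using A X b by (auto simp flip: assoc_mult_mat_vec[OF A X(1) b])
  next
    fix x assume x: "x \<in> carrier_vec n \<and> A *\<^sub>v x = b"
    then show "x = X *\<^sub>v b"
      using assoc_mult_mat_vec[OF X(1) A, of x] X(3) by simp
  qed
qed

section \<open>Local updates\<close>

text \<open>
  The local update is affine with linear part \<open>I\<^sub>j - N S\<^sub>j\<close>; the right-hand side cancels in
  differences.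
\<close>

lemma local_update_diff:
  fixes S IG :: "nat \<Rightarrow> 'a :: field mat"
  assumes IG: "IG j \<in> carrier_mat n n" and S: "S j \<in> carrier_mat n n" and d: "d j \<in> carrier_vec n"
    and N: "mat_inv M \<in> carrier_mat n n" and x: "x \<in> carrier_vec n" and y: "y \<in> carrier_vec n"
  shows "local_update S d IG M j x - local_update S d IG M j y
    = (IG j - mat_inv M * S j) *\<^sub>v (x - y)"
proof -
  let ?N = "mat_inv M"
  have NS: "?N * S j \<in> carrier_mat n n" using N S by auto
  have affine: "local_update S d IG M j z = (IG j *\<^sub>v z - (?N * S j) *\<^sub>v z) + ?N *\<^sub>v d j"
    if z: "z \<in> carrier_vec n" for z
  proof -
    have Sz: "S j *\<^sub>v z \<in> carrier_vec n" using S z by auto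
    have "local_update S d IG M j z = IG j *\<^sub>v z + (?N *\<^sub>v d j - ?N *\<^sub>v (S j *\<^sub>v z))"
      unfolding local_update_def by (simp only: mult_minus_distrib_mat_vec[OF N d Sz])
    also have "?N *\<^sub>v (S j *\<^sub>v z) = (?N * S j) *\<^sub>v z"
      by (rule assoc_mult_mat_vec[OF N S z, symmetric])
    finally show ?thesis
      using IG N d NS z by (intro eq_vecI) (auto simp del: assoc_mult_mat_vec)
  qed
  have "(IG j - ?N * S j) *\<^sub>v (x - y)
      = (IG j *\<^sub>v x - IG j *\<^sub>v y) - ((?N * S j) *\<^sub>v x - (?N * S j) *\<^sub>v y)"
    using minus_mult_distrib_mat_vec[OF IG NS, of "x - y"] x y
      mult_minus_distrib_mat_vec[OF IG x y] mult_minus_distrib_mat_vec[OF NS x y] by simp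
  then show ?thesis
    unfolding affine[OF x] affine[OF y]
    using IG N d NS x y by (intro eq_vecI) (auto simp del: assoc_mult_mat_vec)
qed

lemma local_update_carrier:
  assumes "mat_inv M \<in> carrier_mat n n"
  shows "local_update S d IG M j x \<in> carrier_vec n"
  using assms by (intro carrier_vecI) (simp add: local_update_def)

lemma vec_sum_carrier:
  assumes "\<And>j. j \<in> J \<Longrightarrow> f j \<in> carrier_vec n"
  shows "vec_sum n f J \<in> carrier_vec n"
  using assms by (intro finsum_vec_closed) auto

text \<open>
  The identity parts sum to \<open>x\<close>. The corrections sum to \<open>N\<close> applied to the sum of the local
  residuals, which is the residual of the interface problem and vanishes.
\<close>

lemma sum_local_update_solution:
  fixes S IG :: "nat \<Rightarrow> 'a :: field mat"
  assumes J: "finite J"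
    and IG: "\<And>j. j \<in> J \<Longrightarrow> IG j \<in> carrier_mat n n" and IG_sum: "mat_sum n IG J = 1\<^sub>m n"
    and S: "\<And>j. j \<in> J \<Longrightarrow> S j \<in> carrier_mat n n" and d: "\<And>j. j \<in> J \<Longrightarrow> d j \<in> carrier_vec n"
    and N: "mat_inv M \<in> carrier_mat n n"
    and x: "x \<in> carrier_vec n" and sol: "mat_sum n S J *\<^sub>v x = vec_sum n d J" and l: "l < n"
  shows "(\<Sum>j\<in>J. local_update S d IG M j x $ l) = x $ l"
proof -
  let ?N = "mat_inv M"
  have residual: "(\<Sum>j\<in>J. (d j - S j *\<^sub>v x) $ t) = 0" if t: "t < n" for t
  proof -
    have "(\<Sum>j\<in>J. (d j - S j *\<^sub>v x) $ t) = (\<Sum>j\<in>J. d j $ t - (S j *\<^sub>v x) $ t)"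
      using S t by (intro sum.cong refl index_minus_vec) fastforce
    also have "\<dots> = vec_sum n d J $ t - (mat_sum n S J *\<^sub>v x) $ t"
      using index_finsum_vec[OF J t, of d] d
      by (simp add: sum_subtractf mat_sum_mult_vec[OF S x t] Pi_iff del: index_mult_mat_vec)
    finally show ?thesis using sol by simp
  qed
  have "local_update S d IG M j x $ l
      = (IG j *\<^sub>v x) $ l + (\<Sum>t<n. ?N $$ (l, t) * (d j - S j *\<^sub>v x) $ t)" if j: "j \<in> J" for j
  proof -
    have "d j - S j *\<^sub>v x \<in> carrier_vec n" using S[OF j] d[OF j] x by auto
    from index_mult_mat_vec_sum[OF N this l] show ?thesis
      using N l unfolding local_update_def by (simp del: index_mult_mat_vec)
  qed
  then have "(\<Sum>j\<in>J. local_update S d IG M j x $ l)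
      = (\<Sum>j\<in>J. (IG j *\<^sub>v x) $ l) + (\<Sum>j\<in>J. \<Sum>t<n. ?N $$ (l, t) * (d j - S j *\<^sub>v x) $ t)"
    by (simp add: sum.distrib)
  also have "(\<Sum>j\<in>J. (IG j *\<^sub>v x) $ l) = x $ l"
    using mat_sum_mult_vec[of J IG n x l, OF IG x l] IG_sum x by simp
  also have "(\<Sum>j\<in>J. \<Sum>t<n. ?N $$ (l, t) * (d j - S j *\<^sub>v x) $ t)
      = (\<Sum>t<n. ?N $$ (l, t) * (\<Sum>j\<in>J. (d j - S j *\<^sub>v x) $ t))"
    by (subst sum.swap) (simp add: sum_distrib_left)
  also have "\<dots> = 0" using residual by simp
  finally show ?thesis by simp
qed

section \<open>Convergence of the asynchronous primal Schur method\<close>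

text \<open>
  A negative term makes all terms nonpositive; without one, all terms are nonnegative. In both cases
  the triangle inequality is an equality.
\<close>

lemma abs_sum_same_sign:
  fixes q :: "'b \<Rightarrow> real"
  assumes "\<And>i j. i \<in> J \<Longrightarrow> j \<in> J \<Longrightarrow> q i < 0 \<Longrightarrow> q j \<le> 0"
  shows "\<bar>\<Sum>j\<in>J. q j\<bar> = (\<Sum>j\<in>J. \<bar>q j\<bar>)"
proof (cases "\<exists>i\<in>J. q i < 0")
  case True
  then have "\<And>j. j \<in> J \<Longrightarrow> q j \<le> 0" using assms by blast
  then show ?thesis by (simp add: sum_nonpos abs_of_nonpos flip: sum_negf)
next
  case False
  then have "\<And>j. j \<in> J \<Longrightarrow> 0 \<le> q j" by force
  then show ?thesis by (simp add: sum_nonneg)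
qed

theorem corollary1:
  fixes p n :: nat
    and m :: "nat \<Rightarrow> nat"
    and AII AIG AGI AGG :: "nat \<Rightarrow> 'a :: real_normed_field mat"
    and bI bG :: "nat \<Rightarrow> 'a vec"
    and S IG :: "nat \<Rightarrow> 'a mat"
    and d :: "nat \<Rightarrow> 'a vec"
    and M :: "'a mat"
    and q :: "nat \<Rightarrow> nat \<Rightarrow> nat \<Rightarrow> real"
  assumes AII: "\<And>i. i \<in> {1..p} \<Longrightarrow> AII i \<in> carrier_mat (m i) (m i) \<and> invertible_mat (AII i)"
    and AIG: "\<And>i. i \<in> {1..p} \<Longrightarrow> AIG i \<in> carrier_mat (m i) n"
    and AGI: "\<And>i. i \<in> {1..p} \<Longrightarrow> AGI i \<in> carrier_mat n (m i)"
    and AGG: "\<And>i. i \<in> {1..p} \<Longrightarrow> AGG i \<in> carrier_mat n n"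
    and bI: "\<And>i. i \<in> {1..p} \<Longrightarrow> bI i \<in> carrier_vec (m i)"
    and bG: "\<And>i. i \<in> {1..p} \<Longrightarrow> bG i \<in> carrier_vec n"
    and S: "\<And>i. i \<in> {1..p} \<Longrightarrow> S i = schur_complement (AII i) (AIG i) (AGI i) (AGG i)"
    and d: "\<And>i. i \<in> {1..p} \<Longrightarrow> d i = schur_rhs (AII i) (AGI i) (bI i) (bG i)"
    and M: "M \<in> carrier_mat n n" "invertible_mat M"
    and IG: "\<And>i. i \<in> {1..p} \<Longrightarrow> IG i \<in> carrier_mat n n"
    and IG_sum: "mat_sum n IG {1..p} = 1\<^sub>m n"
    and q: "\<And>i. i \<in> {1..p} \<Longrightarrow>
              IG i - mat_inv M * S i = mat n n (\<lambda>(l, t). of_real (q i l t))"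
    and q_neg: "\<And>i j l t. i \<in> {1..p} \<Longrightarrow> j \<in> {1..p} \<Longrightarrow> l < n \<Longrightarrow> t < n \<Longrightarrow>
              q i l t < 0 \<Longrightarrow> q j l t \<le> 0"
    and q_pos: "\<And>i j l t. i \<in> {1..p} \<Longrightarrow> j \<in> {1..p} \<Longrightarrow> l < n \<Longrightarrow> t < n \<Longrightarrow>
              q i l t > 0 \<Longrightarrow> q j l t \<ge> 0"
    and rho: "real_spectral_radius (mat_abs (1\<^sub>m n - mat_inv M * mat_sum n S {1..p})) < 1"
  shows "async_primal_schur_convergent p n S d IG M"
proof -
  let ?N = "mat_inv M" and ?SS = "mat_sum n S {1..p}"
  define b where "b l t = (\<Sum>j\<in>{1..p}. \<bar>q j l t\<bar>)" for l t
  have N: "?N \<in> carrier_mat n n" by (rule mat_inv_carrier[OF M])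
  have S_carrier: "S i \<in> carrier_mat n n" if "i \<in> {1..p}" for i
    using S[OF that] AGI[OF that] AIG[OF that] by (auto simp: schur_complement_def)
  have d_carrier: "d i \<in> carrier_vec n" if "i \<in> {1..p}" for i
    using d[OF that] AGI[OF that] by (intro carrier_vecI) (auto simp: schur_rhs_def)
  have NSS: "?N * ?SS \<in> carrier_mat n n" using N by auto
  have entry: "(1\<^sub>m n - ?N * ?SS) $$ (l, t) = of_real (\<Sum>j\<in>{1..p}. q j l t)"
    if lt: "l < n" "t < n" for l t
  proof -
    have "(1\<^sub>m n - ?N * ?SS) $$ (l, t) = mat_sum n IG {1..p} $$ (l, t) - (?N * ?SS) $$ (l, t)"
      using lt NSS by (auto simp only: IG_sum index_minus_mat carrier_matD index_one_mat)
    also have "\<dots> = (\<Sum>j\<in>{1..p}. IG j $$ (l, t) - (?N * S j) $$ (l, t))"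
      using lt by (simp only: mult_mat_sum[OF S_carrier N lt] index_mat_sum sum_subtractf)
    also have "\<dots> = (\<Sum>j\<in>{1..p}. of_real (q j l t))"
    proof (intro sum.cong refl)
      fix j assume j: "j \<in> {1..p}"
      have "?N * S j \<in> carrier_mat n n" using N S_carrier[OF j] by auto
      then have "IG j $$ (l, t) - (?N * S j) $$ (l, t) = (IG j - ?N * S j) $$ (l, t)"
        using lt by (intro index_minus_mat(1)[symmetric]) auto
      then show "IG j $$ (l, t) - (?N * S j) $$ (l, t) = of_real (q j l t)"
        using lt by (simp add: q[OF j])
    qed
    finally show ?thesis by simp
  qed
  \<comment> \<open>By the sign condition the absolute value of the summed entry is the sum \<open>b l t\<close>, so the
    spectral radius hypothesis is about the matrix that bounds the asynchronous errors.\<close>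
  have norm_entry: "norm ((1\<^sub>m n - ?N * ?SS) $$ (l, t)) = b l t" if "l < n" "t < n" for l t
    unfolding entry[OF that] norm_of_real b_def
    using q_neg that by (intro abs_sum_same_sign) blast
  have abs_carrier: "mat_abs (1\<^sub>m n - ?N * ?SS) \<in> carrier_mat n n"
    using minus_carrier_mat[OF NSS] by (simp add: mat_abs_def)
  have abs_entry: "mat_abs (1\<^sub>m n - ?N * ?SS) $$ (l, t) = b l t" if "l < n" "t < n" for l t
    using norm_entry[OF that] that carrier_matD[OF minus_carrier_mat[OF NSS]]
    by (simp add: mat_abs_def)
  have b_nonneg: "0 \<le> b l t" for l t by (simp add: b_def sum_nonneg)
  obtain w \<alpha> where w: "\<And>l. l < n \<Longrightarrow> 0 < w l" and \<alpha>: "0 \<le> \<alpha>" "\<alpha> < 1"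
    and bw: "\<And>l. l < n \<Longrightarrow> (\<Sum>t<n. b l t * w t) \<le> \<alpha> * w l"
    using weights_of_spectral_radius_less_1[OF abs_carrier _ rho] abs_entry b_nonneg by auto
  have kernel: "v = 0\<^sub>v n" if v: "v \<in> carrier_vec n" and Sv: "?SS *\<^sub>v v = 0\<^sub>v n" for v
  proof -
    have "(1\<^sub>m n - ?N * ?SS) *\<^sub>v v = v"
      using minus_mult_distrib_mat_vec[OF one_carrier_mat NSS v] v Sv N
        assoc_mult_mat_vec[OF N mat_sum_carrier v] by auto
    then have v_eq: "v $ l = (\<Sum>t<n. (1\<^sub>m n - ?N * ?SS) $$ (l, t) * v $ t)" if "l < n" for l
      using index_mult_mat_vec_sum[OF minus_carrier_mat[OF NSS, of "1\<^sub>m n"] v that] by metis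
    have "norm (v $ l) \<le> (\<Sum>t<n. b l t * norm (v $ t))" if l: "l < n" for l
    proof -
      have "norm (v $ l) \<le> (\<Sum>t<n. norm ((1\<^sub>m n - ?N * ?SS) $$ (l, t) * v $ t))"
        by (subst v_eq[OF l]) (rule norm_sum)
      also have "\<dots> = (\<Sum>t<n. b l t * norm (v $ t))"
        by (intro sum.cong refl) (simp only: norm_mult norm_entry[OF l] lessThan_iff)
      finally show ?thesis .
    qed
    then have "norm (v $ l) = 0" if l: "l < n" for l
      by (intro weighted_subinvariant_imp_zero[where e = "\<lambda>l. norm (v $ l)", OF _ w bw \<alpha>(2) _ _ l]
        b_nonneg norm_ge_zero)
    then show ?thesis using v by (intro eq_vecI) auto
  qed
  have unique: "\<exists>!xs. xs \<in> carrier_vec n \<and> ?SS *\<^sub>v xs = vec_sum n d {1..p}"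
    using kernel d_carrier by (intro unique_solution_of_trivial_kernel vec_sum_carrier) auto
  have conv: "(\<lambda>k. x i k $ l) \<longlonglongrightarrow> xs $ l"
    if xs: "xs \<in> carrier_vec n" and sol: "?SS *\<^sub>v xs = vec_sum n d {1..p}"
      and x0: "\<forall>i\<in>{1..p}. x0 i \<in> carrier_vec n" and sched: "async_schedule p P \<tau>"
      and seq: "async_primal_schur_sequence p n S d IG M x0 P \<tau> x"
      and i: "i \<in> {1..p}" and l: "l < n"
    for xs :: "'a vec" and x0 P \<tau> and x :: "nat \<Rightarrow> nat \<Rightarrow> 'a vec" and i l
  proof -
    let ?upd = "local_update S d IG M"
    have x_Suc: "x i (Suc k) = (if i \<in> P k
        then vec_sum n (\<lambda>j. ?upd j (x j (\<tau> i j k))) {1..p} else x i k)" if "i \<in> {1..p}" for i k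
      using seq that by (auto simp: async_primal_schur_sequence_def)
    have x_carrier: "x i k \<in> carrier_vec n" if i: "i \<in> {1..p}" for i k
    proof (induction k)
      case 0
      then show ?case using seq x0 i by (auto simp: async_primal_schur_sequence_def)
    next
      case (Suc k)
      then show ?case
        unfolding x_Suc[OF i] using vec_sum_carrier[OF local_update_carrier[OF N]] by auto
    qed
    define e where "e i k l = norm (x i k $ l - xs $ l)" for i k l
    have error: "e i (Suc k) l \<le> (\<Sum>j\<in>{1..p}. \<Sum>t<n. \<bar>q j l t\<bar> * e j (\<tau> i j k) t)"
      if i: "i \<in> {1..p}" and Pk: "i \<in> P k" and l: "l < n" for i k l
    proof -
      have diff: "?upd j (x j (\<tau> i j k)) $ l - ?upd j xs $ l
          = (\<Sum>t<n. of_real (q j l t) * (x j (\<tau> i j k) $ t - xs $ t))" if j: "j \<in> {1..p}" for j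
      proof -
        let ?y = "x j (\<tau> i j k)"
        have y: "?y \<in> carrier_vec n" by (rule x_carrier[OF j])
        have NSj: "?N * S j \<in> carrier_mat n n" using N S_carrier[OF j] by auto
        then have T: "IG j - ?N * S j \<in> carrier_mat n n" by (rule minus_carrier_mat)
        have "?upd j ?y $ l - ?upd j xs $ l = (?upd j ?y - ?upd j xs) $ l"
          using carrier_vecD[OF local_update_carrier[OF N]] l
          by (intro index_minus_vec(1)[symmetric]) simp
        also have "\<dots> = ((IG j - ?N * S j) *\<^sub>v (?y - xs)) $ l"
          by (simp only: local_update_diff[where IG = IG and S = S and d = d,
            OF IG[OF j] S_carrier[OF j] d_carrier[OF j] N y xs])
        also have "\<dots> = (\<Sum>t<n. (IG j - ?N * S j) $$ (l, t) * (?y - xs) $ t)"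
          using y xs l by (intro index_mult_mat_vec_sum[OF T]) auto
        also have "\<dots> = (\<Sum>t<n. of_real (q j l t) * (?y $ t - xs $ t))"
          using y xs l by (intro sum.cong) (auto simp: q[OF j])
        finally show ?thesis .
      qed
      have "x i (Suc k) $ l - xs $ l
          = (\<Sum>j\<in>{1..p}. ?upd j (x j (\<tau> i j k)) $ l) - (\<Sum>j\<in>{1..p}. ?upd j xs $ l)"
      proof -
        have "x i (Suc k) $ l = (\<Sum>j\<in>{1..p}. ?upd j (x j (\<tau> i j k)) $ l)"
          unfolding x_Suc[OF i] if_P[OF Pk]
          using l local_update_carrier[OF N] by (intro index_finsum_vec) blast+
        moreover have "(\<Sum>j\<in>{1..p}. ?upd j xs $ l) = xs $ l"
          by (rule sum_local_update_solution[OF finite_atLeastAtMost IG IG_sum S_carrier d_carrier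
            N xs sol l])
        ultimately show ?thesis by argo
      qed
      also have "\<dots> = (\<Sum>j\<in>{1..p}. \<Sum>t<n. of_real (q j l t) * (x j (\<tau> i j k) $ t - xs $ t))"
        unfolding sum_subtractf[symmetric] by (intro sum.cong refl diff)
      finally have "e i (Suc k) l
          = norm (\<Sum>j\<in>{1..p}. \<Sum>t<n. of_real (q j l t) * (x j (\<tau> i j k) $ t - xs $ t))"
        by (simp add: e_def)
      also have "\<dots> \<le> (\<Sum>j\<in>{1..p}. \<Sum>t<n. norm (of_real (q j l t) * (x j (\<tau> i j k) $ t - xs $ t)))"
        by (rule order_trans[OF norm_sum]) (intro sum_mono norm_sum)
      finally show ?thesis by (simp add: e_def norm_mult)
    qed
    have "(\<lambda>k. e i k l) \<longlonglongrightarrow> 0"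
    proof (rule async_weighted_max_norm_contraction[where e = e and w = w and n = n and \<alpha> = \<alpha>,
        OF sched _ w \<alpha> _ _ i l])
      fix i k l C
      assume i: "i \<in> {1..p}" and Pk: "i \<in> P k" and l: "l < n" and C: "(0 :: real) \<le> C"
        and le: "\<And>j t. j \<in> {1..p} \<Longrightarrow> t < n \<Longrightarrow> e j (\<tau> i j k) t \<le> C * w t"
      have "e i (Suc k) l \<le> (\<Sum>j\<in>{1..p}. \<Sum>t<n. \<bar>q j l t\<bar> * (C * w t))"
        using le by (intro order_trans[OF error[OF i Pk l]] sum_mono mult_left_mono) auto
      also have "\<dots> = C * (\<Sum>t<n. b l t * w t)"
        by (subst sum.swap) (simp add: b_def sum_distrib_left sum_distrib_right mult_ac)
      also have "\<dots> \<le> C * (\<alpha> * w l)" using bw[OF l] C by (rule mult_left_mono)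
      finally show "e i (Suc k) l \<le> \<alpha> * C * w l" by (simp add: mult_ac)
    qed (auto simp: e_def x_Suc)
    then have "(\<lambda>k. x i k $ l - xs $ l) \<longlonglongrightarrow> 0"
      unfolding e_def by (rule tendsto_norm_zero_cancel)
    then show ?thesis by (rule LIM_zero_cancel)
  qed
  show ?thesis
    unfolding async_primal_schur_convergent_def
  proof (intro conjI allI impI ballI)
    show "\<exists>!xs. xs \<in> carrier_vec n \<and> ?SS *\<^sub>v xs = vec_sum n d {1..p}" by (rule unique)
  qed (elim conjE, rule conv)
qed

end
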